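(* (Subject reduction.) For all terms $r,s$ and every type $A$: if $r:A$ and ($r\hookrightarrow s$ or $r\rightleftarrows s$), then $s:A$.
   Context: Types: $A,B,C::=\tau\mid A\Rightarrow B\mid A\wedge B$ with a single atomic type $\tau$ ($\Rightarrow$ associates to the right). $\equiv$ is the smallest congruence on types containing $A\wedge B\equiv B\wedge A$, $(A\wedge B)\wedge C\equiv A\wedge(B\wedge C)$, $A\Rightarrow(B\wedge C)\equiv(A\Rightarrow B)\wedge(A\Rightarrow C)$, $(A\wedge B)\Rightarrow C\equiv A\Rightarrow B\Rightarrow C$. Terms: $r,s,t::=x^A\mid \lambda x^A.r\mid r\,s\mid r+s\mid \pi_A(r)$; every variable occurrence carries a type label; terms up to $\alpha$-equivalence. $\mathrm{vars}(r)$ is the set of labelled variables (free and bound) of $r$. A set of labelled variables is functional if $x^A,x^B$ in it implies $A=B$. $r[s/x]$ is capture-avoiding substitution; $r[A/B]$ replaces every syntactic occurrence of type $B$ in $r$ (labels and projection subscripts) by $A$. Typing (judgements $r:A$, no contexts): $x^A:A$; if $r:A$ and $A\equiv B$ then $r:B$; if $r:B$ and $\mathrm{vars}(r)\cup\{x^A\}$ functional then $\lambda x^A.r:A\Rightarrow B$; if $r:A\Rightarrow B$, $s:A$, $\mathrm{vars}(rs)$ functional then $rs:B$; if $r:A$, $s:B$, $\mathrm{vars}(r+s)$ functional then $r+s:A\wedge B$; if $r:A$ then $\pi_A(r):A$; if $r:A\wedge B$ then $\pi_A(r):A$. Symmetric relation $\rightleftarrows$ (each rule in both directions): $r+s\rightleftarrows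 s+r$; $(r+s)+t\rightleftarrows r+(s+t)$; $\lambda x^A.(r+s)\rightleftarrows\lambda x^A.r+\lambda x^A.s$; $(r+s)t\rightleftarrows rt+st$; $\pi_{A\Rightarrow B}(\lambda x^A.r)\rightleftarrows\lambda x^A.\pi_B(r)$; if $r:A\Rightarrow(B\wedge C)$ then $\pi_{A\Rightarrow B}(r)s\rightleftarrows\pi_B(rs)$; $(rs)t\rightleftarrows r(s+t)$; if $A\equiv B$ then $r\rightleftarrows r[A/B]$; if $r:A\wedge B$ and $s:C\wedge D$ then $\pi_{A\wedge C}(r+s)\rightleftarrows\pi_A(r)+\pi_C(s)$. $\rightleftarrows^*$ is its reflexive–transitive closure. Reductions $\hookrightarrow$: non-$\delta$ rules: if $s:A$, $(\lambda x^A.r)s\hookrightarrow r[s/x]$; if $r:A$, $\pi_A(r+s)\hookrightarrow r$; if $r:A$, $\pi_A(r)\hookrightarrow r$. $\delta$ rule: if $r:A\wedge B$ and $r$ is not $\rightleftarrows^*$-equivalent to any term of the form $s+t$, then $r\hookrightarrow\pi_A(r)+\pi_B(r)$. Contexts $C[\cdot]::=[\cdot]\mid\lambda x^A.C[\cdot]\mid C[\cdot]r\mid rC[\cdot]\mid C[\cdot]+r\mid r+C[\cdot]\mid\pi_A(C[\cdot])$. If $r\rightleftarrows s$ then $C[r]\rightleftarrows C[s]$; if $r\hookrightarrow s$ by a non-$\delta$ rule then $C[r]\hookrightarrow C[s]$; if $r\hookrightarrow s$ by $\delta$ then $C[r]\hookrightarrow C[s]$ provided $C[\cdot]$ is not $\rightleftarrows^*$-equivalent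 to a context of the form $C'[\pi_A(\cdot)]$.
   Formalization: As printed the claim fails. Two corrections: for r⇄s, vars(s) is assumed functional (else x^B+x^B⇄x^A+x^B with A≡B, A≠B, is a counterexample); the rule π_{A⇒B}(r)s⇄π_B(rs) also requires s:A, since otherwise its two sides can have inequivalent types. *)

theory Defs
  imports Main
begin

datatype ty =
    Tau  ("\<tau>")
  | Imp ty ty  (infixr "\<^bold>\<rightarrow>" 70)
  | Conj ty ty  (infixr "\<^bold>\<and>" 75)

inductive ty_eq :: "ty \<Rightarrow> ty \<Rightarrow> bool"  (infix "\<simeq>" 50) where
  refl: "A \<simeq> A"
| sym: "A \<simeq> B \<Longrightarrow> B \<simeq> A"
| trans: "A \<simeq> B \<Longrightarrow> B \<simeq> C \<Longrightarrow> A \<simeq> C"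
| Imp_cong: "A \<simeq> A' \<Longrightarrow> B \<simeq> B' \<Longrightarrow> (A \<^bold>\<rightarrow> B) \<simeq> (A' \<^bold>\<rightarrow> B')"
| Conj_cong: "A \<simeq> A' \<Longrightarrow> B \<simeq> B' \<Longrightarrow> (A \<^bold>\<and> B) \<simeq> (A' \<^bold>\<and> B')"
| comm: "(A \<^bold>\<and> B) \<simeq> (B \<^bold>\<and> A)"
| assoc: "((A \<^bold>\<and> B) \<^bold>\<and> C) \<simeq> (A \<^bold>\<and> (B \<^bold>\<and> C))"
| distrib: "(A \<^bold>\<rightarrow> (B \<^bold>\<and> C)) \<simeq> ((A \<^bold>\<rightarrow> B) \<^bold>\<and> (A \<^bold>\<rightarrow> C))"
| curry: "((A \<^bold>\<and> B) \<^bold>\<rightarrow> C) \<simeq> (A \<^bold>\<rightarrow> (B \<^bold>\<rightarrow> C))"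

text \<open>
  Terms up to alpha-equivalence are represented with de Bruijn indices. Only the name of a
  variable becomes an index: every occurrence keeps its own type label, which may differ from
  the label of its binder or of another occurrence. Thus \<open>Var i A\<close> is an occurrence
  with label \<open>A\<close> of the variable with index \<open>i\<close>, and \<open>Lam A r\<close> binds index 0
  of \<open>r\<close>, whatever the labels of its occurrences.
\<close>

datatype trm =
    Var nat ty
  | Lam ty trm
  | App trm trm  (infixl "\<cdot>" 80)
  | Plus trm trm  (infixl "\<^bold>+" 78)
  | Proj ty trm

text \<open>
  Free and bound variables of a term. A bound variable is named by the path from the root to
  its binder, so that distinct binders bind distinct names, all different from the free ones:
  the set is that of an alpha-representative whose bound variables are named apart.
\<close>

datatype name = Free nat | Bound "nat list"

fun child :: "nat \<Rightarrow> name \<Rightarrow> name" where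
  "child d (Free i) = Free i"
| "child d (Bound p) = Bound (d # p)"

fun bind :: "name \<Rightarrow> name" where
  "bind (Free 0) = Bound []"
| "bind (Free (Suc i)) = Free i"
| "bind (Bound p) = Bound (0 # p)"

fun vars :: "trm \<Rightarrow> (name \<times> ty) set" where
  "vars (Var i A) = {(Free i, A)}"
| "vars (Lam A r) = map_prod bind id ` (vars r \<union> {(Free 0, A)})"
| "vars (r \<cdot> s) = map_prod (child 0) id ` vars r \<union> map_prod (child 1) id ` vars s"
| "vars (r \<^bold>+ s) = map_prod (child 0) id ` vars r \<union> map_prod (child 1) id ` vars s"
| "vars (Proj A r) = vars r"

abbreviation functional :: "(name \<times> ty) set \<Rightarrow> bool" where
  "functional \<equiv> single_valued"

inductive typed :: "trm \<Rightarrow> ty \<Rightarrow> bool"  (infix "\<Colon>" 50) where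
  Var: "Var i A \<Colon> A"
| Conv: "r \<Colon> A \<Longrightarrow> A \<simeq> B \<Longrightarrow> r \<Colon> B"
| Lam: "r \<Colon> B \<Longrightarrow> functional (vars r \<union> {(Free 0, A)}) \<Longrightarrow> Lam A r \<Colon> A \<^bold>\<rightarrow> B"
| App: "r \<Colon> A \<^bold>\<rightarrow> B \<Longrightarrow> s \<Colon> A \<Longrightarrow> functional (vars (r \<cdot> s)) \<Longrightarrow> r \<cdot> s \<Colon> B"
| Plus: "r \<Colon> A \<Longrightarrow> s \<Colon> B \<Longrightarrow> functional (vars (r \<^bold>+ s)) \<Longrightarrow> r \<^bold>+ s \<Colon> A \<^bold>\<and> B"
| Proj_self: "r \<Colon> A \<Longrightarrow> Proj A r \<Colon> A"
| Proj: "r \<Colon> A \<^bold>\<and> B \<Longrightarrow> Proj A r \<Colon> A"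

fun lift :: "nat \<Rightarrow> trm \<Rightarrow> trm" where
  "lift k (Var i A) = Var (if i < k then i else Suc i) A"
| "lift k (Lam A r) = Lam A (lift (Suc k) r)"
| "lift k (r \<cdot> s) = lift k r \<cdot> lift k s"
| "lift k (r \<^bold>+ s) = lift k r \<^bold>+ lift k s"
| "lift k (Proj A r) = Proj A (lift k r)"

text \<open>\<open>subst k s r\<close> replaces the variable \<open>k\<close> of \<open>r\<close> by \<open>s\<close> and lowers the indices above \<open>k\<close>.\<close>

fun subst :: "nat \<Rightarrow> trm \<Rightarrow> trm \<Rightarrow> trm" where
  "subst k s (Var i A) = (if i = k then s else if k < i then Var (i - 1) A else Var i A)"
| "subst k s (Lam A r) = Lam A (subst (Suc k) (lift 0 s) r)"
| "subst k s (r \<cdot> t) = subst k s r \<cdot> subst k s t"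
| "subst k s (r \<^bold>+ t) = subst k s r \<^bold>+ subst k s t"
| "subst k s (Proj A r) = Proj A (subst k s r)"

text \<open>\<open>ty_repl A B\<close> and \<open>trm_repl A B\<close> are the replacement \<open>[A/B]\<close> of \<open>B\<close> by \<open>A\<close>.\<close>

fun ty_repl :: "ty \<Rightarrow> ty \<Rightarrow> ty \<Rightarrow> ty" where
  "ty_repl A B \<tau> = (if \<tau> = B then A else \<tau>)"
| "ty_repl A B (C \<^bold>\<rightarrow> D) =
     (if (C \<^bold>\<rightarrow> D) = B then A else ty_repl A B C \<^bold>\<rightarrow> ty_repl A B D)"
| "ty_repl A B (C \<^bold>\<and> D) =
     (if (C \<^bold>\<and> D) = B then A else ty_repl A B C \<^bold>\<and> ty_repl A B D)"

fun trm_repl :: "ty \<Rightarrow> ty \<Rightarrow> trm \<Rightarrow> trm" where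
  "trm_repl A B (Var i C) = Var i (ty_repl A B C)"
| "trm_repl A B (Lam C r) = Lam (ty_repl A B C) (trm_repl A B r)"
| "trm_repl A B (r \<cdot> s) = trm_repl A B r \<cdot> trm_repl A B s"
| "trm_repl A B (r \<^bold>+ s) = trm_repl A B r \<^bold>+ trm_repl A B s"
| "trm_repl A B (Proj C r) = Proj (ty_repl A B C) (trm_repl A B r)"

datatype ctx =
    CHole
  | CLam ty ctx
  | CAppL ctx trm
  | CAppR trm ctx
  | CPlusL ctx trm
  | CPlusR trm ctx
  | CProj ty ctx

text \<open>Filling a hole captures variables, hence does not shift indices.\<close>

fun plug :: "ctx \<Rightarrow> trm \<Rightarrow> trm" where
  "plug CHole r = r"
| "plug (CLam A C) r = Lam A (plug C r)"
| "plug (CAppL C s) r = plug C r \<cdot> s"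
| "plug (CAppR s C) r = s \<cdot> plug C r"
| "plug (CPlusL C s) r = plug C r \<^bold>+ s"
| "plug (CPlusR s C) r = s \<^bold>+ plug C r"
| "plug (CProj A C) r = Proj A (plug C r)"

fun ctx_comp :: "ctx \<Rightarrow> ctx \<Rightarrow> ctx" where
  "ctx_comp CHole D = D"
| "ctx_comp (CLam A C) D = CLam A (ctx_comp C D)"
| "ctx_comp (CAppL C s) D = CAppL (ctx_comp C D) s"
| "ctx_comp (CAppR s C) D = CAppR s (ctx_comp C D)"
| "ctx_comp (CPlusL C s) D = CPlusL (ctx_comp C D) s"
| "ctx_comp (CPlusR s C) D = CPlusR s (ctx_comp C D)"
| "ctx_comp (CProj A C) D = CProj A (ctx_comp C D)"

text \<open>
  The premise \<open>s \<Colon> A\<close> of \<open>dist_Proj_App\<close> is not redundant: it fixes which argument the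
  arrow of \<open>A \<^bold>\<rightarrow> B\<close> refers to. With \<open>a = \<tau>\<close>, \<open>b = \<tau> \<^bold>\<rightarrow> \<tau>\<close>, \<open>B = a \<^bold>\<rightarrow> b \<^bold>\<rightarrow> \<tau>\<close>,
  \<open>C = b \<^bold>\<rightarrow> b \<^bold>\<rightarrow> \<tau>\<close>, the variables \<open>r \<Colon> a \<^bold>\<rightarrow> (B \<^bold>\<and> C)\<close> and \<open>s \<Colon> b\<close> give well-typed
  terms on both sides whose types \<open>a \<^bold>\<rightarrow> a \<^bold>\<rightarrow> \<tau>\<close> and \<open>B\<close> are not equivalent, because
  \<open>a \<^bold>\<rightarrow> (B \<^bold>\<and> C) \<simeq> b \<^bold>\<rightarrow> (B \<^bold>\<and> (a \<^bold>\<rightarrow> a \<^bold>\<rightarrow> \<tau>))\<close>.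

  By \<open>repl\<close> and \<open>ctx\<close>, a step may relabel one occurrence of a variable but not another one:
  if \<open>A \<simeq> B\<close>, then \<open>Var 0 B \<^bold>+ Var 0 B \<rightleftharpoons> Var 0 A \<^bold>+ Var 0 B\<close>. The right-hand side is
  not functional for \<open>A \<noteq> B\<close>, hence has no type.
\<close>

inductive equiv_step :: "trm \<Rightarrow> trm \<Rightarrow> bool"  (infix "\<rightleftharpoons>" 50) where
  sym: "r \<rightleftharpoons> s \<Longrightarrow> s \<rightleftharpoons> r"
| ctx: "r \<rightleftharpoons> s \<Longrightarrow> plug C r \<rightleftharpoons> plug C s"
| comm: "r \<^bold>+ s \<rightleftharpoons> s \<^bold>+ r"
| assoc: "(r \<^bold>+ s) \<^bold>+ t \<rightleftharpoons> r \<^bold>+ (s \<^bold>+ t)"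
| dist_Lam: "Lam A (r \<^bold>+ s) \<rightleftharpoons> Lam A r \<^bold>+ Lam A s"
| dist_App: "(r \<^bold>+ s) \<cdot> t \<rightleftharpoons> (r \<cdot> t) \<^bold>+ (s \<cdot> t)"
| dist_Proj_Lam: "Proj (A \<^bold>\<rightarrow> B) (Lam A r) \<rightleftharpoons> Lam A (Proj B r)"
| dist_Proj_App: "r \<Colon> A \<^bold>\<rightarrow> (B \<^bold>\<and> C) \<Longrightarrow> s \<Colon> A \<Longrightarrow> Proj (A \<^bold>\<rightarrow> B) r \<cdot> s \<rightleftharpoons> Proj B (r \<cdot> s)"
| curry: "(r \<cdot> s) \<cdot> t \<rightleftharpoons> r \<cdot> (s \<^bold>+ t)"
| repl: "A \<simeq> B \<Longrightarrow> r \<rightleftharpoons> trm_repl A B r"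
| split: "r \<Colon> A \<^bold>\<and> B \<Longrightarrow> s \<Colon> C \<^bold>\<and> D \<Longrightarrow> Proj (A \<^bold>\<and> C) (r \<^bold>+ s) \<rightleftharpoons> Proj A r \<^bold>+ Proj C s"

text \<open>
  Equivalence of contexts. Since the rules for terms have typing premises, a hole has a type
  \<open>H\<close>; since none of them substitutes or inspects binders, the hole can be taken to be a fresh
  variable labelled \<open>H\<close>. \<open>hole_term 0 H C\<close> is \<open>C\<close> with this variable, which has index 0 in the
  result, the other free variables being shifted; the first argument counts the binders
  above. The hole may be relabelled by a type replacement, so steps relate pairs of a context
  and the type of its hole.
\<close>

fun hole_term :: "nat \<Rightarrow> ty \<Rightarrow> ctx \<Rightarrow> trm" where
  "hole_term k H CHole = Var k H"
| "hole_term k H (CLam A C) = Lam A (hole_term (Suc k) H C)"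
| "hole_term k H (CAppL C s) = hole_term k H C \<cdot> lift k s"
| "hole_term k H (CAppR s C) = lift k s \<cdot> hole_term k H C"
| "hole_term k H (CPlusL C s) = hole_term k H C \<^bold>+ lift k s"
| "hole_term k H (CPlusR s C) = lift k s \<^bold>+ hole_term k H C"
| "hole_term k H (CProj A C) = Proj A (hole_term k H C)"

definition ctx_equiv_step :: "ctx \<times> ty \<Rightarrow> ctx \<times> ty \<Rightarrow> bool" where
  "ctx_equiv_step = (\<lambda>(C, H) (C', H'). hole_term 0 H C \<rightleftharpoons> hole_term 0 H' C')"

inductive red_nd :: "trm \<Rightarrow> trm \<Rightarrow> bool"  (infix "\<hookrightarrow>\<^sub>0" 50) where
  beta: "s \<Colon> A \<Longrightarrow> Lam A r \<cdot> s \<hookrightarrow>\<^sub>0 subst 0 s r"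
| Proj_Plus: "r \<Colon> A \<Longrightarrow> Proj A (r \<^bold>+ s) \<hookrightarrow>\<^sub>0 r"
| Proj_self: "r \<Colon> A \<Longrightarrow> Proj A r \<hookrightarrow>\<^sub>0 r"

inductive red :: "trm \<Rightarrow> trm \<Rightarrow> bool"  (infix "\<hookrightarrow>" 50) where
  nd: "r \<hookrightarrow>\<^sub>0 s \<Longrightarrow> plug C r \<hookrightarrow> plug C s"
| delta:
    "r \<Colon> A \<^bold>\<and> B \<Longrightarrow>
     \<not> (\<exists>s t. equiv_step\<^sup>*\<^sup>* r (s \<^bold>+ t)) \<Longrightarrow>
     \<not> (\<exists>C' D H. ctx_equiv_step\<^sup>*\<^sup>* (C, A \<^bold>\<and> B) (ctx_comp C' (CProj D CHole), H)) \<Longrightarrow>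
     plug C r \<hookrightarrow> plug C (Proj A r \<^bold>+ Proj B r)"

end

theory Submission
  imports Defs "HOL-Library.Multiset"
begin

text \<open>
  Modulo \<open>\<simeq>\<close>, a type is a non-empty multiset of factors \<open>A\<^sub>1 \<^bold>\<rightarrow> \<dots> \<^bold>\<rightarrow> A\<^sub>n \<^bold>\<rightarrow> \<tau>\<close>, and a
  factor is determined by the multiset of its arguments, which are again factors. Hence \<open>\<simeq>\<close> is equality of normal forms, from which one reads off the
  two facts that inverting typing derivations requires: \<open>A \<^bold>\<rightarrow> B \<simeq> A \<^bold>\<rightarrow> B'\<close> implies \<open>B \<simeq> B'\<close>, so types
  are unique, and \<open>C \<^bold>\<and> D \<simeq> A \<^bold>\<rightarrow> B\<close> splits \<open>B\<close> into a conjunction. For \<open>\<hookrightarrow>\<close> the target is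
  functional because steps create no labelled free variables: since bound names are kept apart,
  functionality of a compound only depends on its parts and their labelled free variables.
\<close>

section \<open>Types modulo isomorphism\<close>

declare ty_eq.refl [simp]
declare ty_eq.trans [trans]

section \<open>Normal forms of types as multisets of factors\<close>

datatype factor = Factor "factor multiset"

primrec arguments :: "factor \<Rightarrow> factor multiset" where
  "arguments (Factor M) = M"

text \<open>The clause for arrows is \<open>distrib\<close> followed by \<open>curry\<close>: the
  arrow is spread over the factors of \<open>B\<close>, and the factors of \<open>A\<close> join the
  arguments of each of them.\<close>

primrec factors :: "ty \<Rightarrow> factor multiset" where
  "factors \<tau> = {#Factor {#}#}"
| "factors (A \<^bold>\<rightarrow> B) = image_mset (\<lambda>p. Factor (factors A + arguments p)) (factors B)"
| "factors (A \<^bold>\<and> B) = factors A + factors B"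

lemma factors_nonempty [simp]: "factors A \<noteq> {#}"
  by (induction A) auto

text \<open>Each isomorphism becomes a multiset identity: \<open>comm\<close> and
  \<open>assoc\<close> are those of the sum, \<open>distrib\<close> is the image of a sum,
  \<open>curry\<close> is associativity of the sum of arguments.\<close>

lemma factors_eq_if_ty_eq: "A \<simeq> B \<Longrightarrow> factors A = factors B"
  by (induction rule: ty_eq.induct) (auto simp: image_mset.compositionality o_def ac_simps)

section \<open>Iterated conjunctions and implications up to \<simeq>\<close>

fun conj_list :: "ty list \<Rightarrow> ty" where
  "conj_list [] = \<tau>"
| "conj_list [A] = A"
| "conj_list (A # B # As) = A \<^bold>\<and> conj_list (B # As)"

lemma conj_list_Cons: "As \<noteq> [] \<Longrightarrow> conj_list (A # As) = A \<^bold>\<and> conj_list As"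
  by (cases As) auto

lemma conj_list_append:
  "\<lbrakk>As \<noteq> []; Bs \<noteq> []\<rbrakk> \<Longrightarrow> conj_list (As @ Bs) \<simeq> conj_list As \<^bold>\<and> conj_list Bs"
proof (induction As rule: conj_list.induct)
  case (3 A B As)
  then have "conj_list ((A # B # As) @ Bs) \<simeq> A \<^bold>\<and> (conj_list (B # As) \<^bold>\<and> conj_list Bs)"
    by (auto intro: ty_eq.intros)
  then show ?case
    by (metis ty_eq.assoc ty_eq.sym ty_eq.trans conj_list.simps(3))
qed (auto simp: conj_list_Cons)

lemma conj_left_commute: "A \<^bold>\<and> B \<^bold>\<and> C \<simeq> B \<^bold>\<and> A \<^bold>\<and> C"
  by (meson ty_eq.intros)

text \<open>The premise excludes the one-element list: conjunction has no unit, so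
  \<open>conj_list []\<close> is only a placeholder.\<close>

lemma conj_list_middle:
  assumes "As @ Bs \<noteq> []"
  shows "conj_list (As @ A # Bs) \<simeq> A \<^bold>\<and> conj_list (As @ Bs)"
proof (cases "As = [] \<or> Bs = []")
  case True
  then show ?thesis
    using assms conj_list_append[of As "[A]"] ty_eq.comm[of "conj_list As" A]
    by (auto simp: conj_list_Cons intro: ty_eq.trans)
next
  case False
  then have "conj_list (As @ A # Bs) \<simeq> conj_list As \<^bold>\<and> A \<^bold>\<and> conj_list Bs"
    using conj_list_append[of As "A # Bs"] by (simp add: conj_list_Cons)
  also have "\<dots> \<simeq> A \<^bold>\<and> conj_list As \<^bold>\<and> conj_list Bs"
    by (rule conj_left_commute)
  also have "\<dots> \<simeq> A \<^bold>\<and> conj_list (As @ Bs)"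
    using False conj_list_append by (auto intro: ty_eq.intros)
  finally show ?thesis .
qed

text \<open>Induction on \<open>As\<close>: its head is located in \<open>Bs\<close> and pulled to
  the front by \<open>conj_list_middle\<close>.\<close>

lemma conj_list_perm: "mset As = mset Bs \<Longrightarrow> conj_list As \<simeq> conj_list Bs"
proof (induction As arbitrary: Bs)
  case (Cons A As)
  obtain Cs Ds where Bs: "Bs = Cs @ A # Ds"
    by (metis Cons.prems list.set_intros(1) set_mset_mset split_list)
  have eq: "mset As = mset (Cs @ Ds)"
    using Cons.prems Bs by simp
  show ?case
  proof (cases "As = []")
    case True
    then show ?thesis using eq Bs by simp
  next
    case False
    then have "Cs @ Ds \<noteq> []" using eq by auto
    then have "A \<^bold>\<and> conj_list (Cs @ Ds) \<simeq> conj_list Bs"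
      using conj_list_middle Bs ty_eq.sym by blast
    moreover have "A \<^bold>\<and> conj_list As \<simeq> A \<^bold>\<and> conj_list (Cs @ Ds)"
      using Cons.IH[OF eq] by (auto intro: ty_eq.intros)
    ultimately show ?thesis
      using False by (auto simp: conj_list_Cons intro: ty_eq.trans)
  qed
qed auto

lemma conj_list_cong:
  "list_all2 ty_eq As Bs \<Longrightarrow> conj_list As \<simeq> conj_list Bs"
proof (induction As Bs rule: list_all2_induct)
  case (Cons A As B Bs)
  then show ?case
    by (cases "As = []"; cases "Bs = []") (auto simp: conj_list_Cons intro: ty_eq.Conj_cong)
qed auto

lemma imp_conj_list: "As \<noteq> [] \<Longrightarrow> A \<^bold>\<rightarrow> conj_list As \<simeq> conj_list (map (Imp A) As)"
proof (induction As rule: conj_list.induct)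
  case (3 B C As)
  then show ?case
    by simp (meson ty_eq.Conj_cong ty_eq.distrib ty_eq.refl ty_eq.trans)
qed auto

abbreviation imp_list :: "ty list \<Rightarrow> ty \<Rightarrow> ty" where
  "imp_list \<equiv> foldr Imp"

text \<open>Uncurry, commute the conjunction, curry again.\<close>

lemma imp_left_commute: "A \<^bold>\<rightarrow> B \<^bold>\<rightarrow> C \<simeq> B \<^bold>\<rightarrow> A \<^bold>\<rightarrow> C"
  by (meson ty_eq.intros)

text \<open>Short lists need no exception here, since the result type \<open>C\<close> ends every
  list of arguments.\<close>

lemma imp_list_middle: "imp_list (As @ A # Bs) C \<simeq> A \<^bold>\<rightarrow> imp_list (As @ Bs) C"
proof (induction As)
  case (Cons B As)
  then have "imp_list ((B # As) @ A # Bs) C \<simeq> B \<^bold>\<rightarrow> A \<^bold>\<rightarrow> imp_list (As @ Bs) C"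
    by (auto intro: ty_eq.intros)
  also have "\<dots> \<simeq> A \<^bold>\<rightarrow> B \<^bold>\<rightarrow> imp_list (As @ Bs) C"
    by (rule imp_left_commute)
  finally show ?case by simp
qed auto

lemma imp_list_perm: "mset As = mset Bs \<Longrightarrow> imp_list As C \<simeq> imp_list Bs C"
proof (induction As arbitrary: Bs)
  case (Cons A As)
  obtain Cs Ds where Bs: "Bs = Cs @ A # Ds"
    by (metis Cons.prems list.set_intros(1) set_mset_mset split_list)
  then have "imp_list As C \<simeq> imp_list (Cs @ Ds) C"
    using Cons.prems by (intro Cons.IH) simp
  then have "A \<^bold>\<rightarrow> imp_list As C \<simeq> A \<^bold>\<rightarrow> imp_list (Cs @ Ds) C"
    by (intro ty_eq.Imp_cong ty_eq.refl)
  also have "\<dots> \<simeq> imp_list Bs C"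
    unfolding Bs by (rule ty_eq.sym[OF imp_list_middle])
  finally show ?case by simp
qed auto

lemma conj_list_imp: "As \<noteq> [] \<Longrightarrow> conj_list As \<^bold>\<rightarrow> C \<simeq> imp_list As C"
proof (induction As rule: conj_list.induct)
  case (3 A B As)
  then show ?case
    by simp (meson ty_eq.Imp_cong ty_eq.curry ty_eq.refl ty_eq.trans)
qed auto

section \<open>Reading types back from normal forms\<close>

definition list_of_mset :: "'a multiset \<Rightarrow> 'a list" where
  "list_of_mset M = (SOME xs. mset xs = M)"

lemma mset_list_of_mset [simp]: "mset (list_of_mset M) = M"
  unfolding list_of_mset_def by (rule someI_ex[OF ex_mset])

lemma list_of_mset_eq_Nil [simp]: "list_of_mset M = [] \<longleftrightarrow> M = {#}"
  by (metis mset_list_of_mset mset_zero_iff)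

text \<open>An order is chosen only after mapping, because primitive recursion through a multiset
  offers the recursive results as an image. By \<open>imp_list_perm\<close> the choice does not
  matter up to \<simeq>.\<close>

primrec factor_ty :: "factor \<Rightarrow> ty" where
  "factor_ty (Factor M) = imp_list (list_of_mset (image_mset factor_ty M)) \<tau>"

definition factors_ty :: "factor multiset \<Rightarrow> ty" where
  "factors_ty M = conj_list (map factor_ty (list_of_mset M))"

lemma factors_ty_add:
  assumes "M \<noteq> {#}" "N \<noteq> {#}"
  shows "factors_ty (M + N) \<simeq> factors_ty M \<^bold>\<and> factors_ty N"
proof -
  have "factors_ty (M + N) \<simeq>
      conj_list (map factor_ty (list_of_mset M) @ map factor_ty (list_of_mset N))"
    unfolding factors_ty_def by (rule conj_list_perm) simp
  also have "\<dots> \<simeq> factors_ty M \<^bold>\<and> factors_ty N"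
    unfolding factors_ty_def using assms by (intro conj_list_append) auto
  finally show ?thesis .
qed

text \<open>Iterated currying turns the factors in \<open>M\<close> into arguments in front of those
  of \<open>p\<close>; the resulting list and the chosen one differ by a permutation.\<close>

lemma imp_factor_ty:
  assumes "M \<noteq> {#}"
  shows "factors_ty M \<^bold>\<rightarrow> factor_ty p \<simeq> factor_ty (Factor (M + arguments p))"
proof -
  obtain N where p: "p = Factor N" by (cases p)
  let ?As = "map factor_ty (list_of_mset M)"
  let ?Bs = "list_of_mset (image_mset factor_ty N)"
  have "factors_ty M \<^bold>\<rightarrow> factor_ty p \<simeq> imp_list ?As (imp_list ?Bs \<tau>)"
    unfolding p factors_ty_def factor_ty.simps using assms by (intro conj_list_imp) auto
  also have "\<dots> = imp_list (?As @ ?Bs) \<tau>"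
    by simp
  also have "\<dots> \<simeq> imp_list (list_of_mset (image_mset factor_ty (M + N))) \<tau>"
    by (rule imp_list_perm) simp
  finally show ?thesis by (simp add: p)
qed

lemma ty_eq_factors_ty: "A \<simeq> factors_ty (factors A)"
proof (induction A)
  case Tau
  \<comment> \<open>Multisets with at most one element have a unique enumeration, so the chosen
    lists can be computed.\<close>
  have "list_of_mset {#Factor {#}#} = [Factor {#}]"
    by (metis mset_list_of_mset mset_single_iff)
  moreover have "list_of_mset ({#} :: ty multiset) = []"
    by simp
  ultimately show ?case by (simp add: factors_ty_def del: list_of_mset_eq_Nil)
next
  case (Imp A B)
  let ?ps = "list_of_mset (factors B)"
  let ?g = "\<lambda>p. Factor (factors A + arguments p)"
  have "A \<^bold>\<rightarrow> B \<simeq> factors_ty (factors A) \<^bold>\<rightarrow> factors_ty (factors B)"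
    using Imp by (rule ty_eq.Imp_cong)
  \<comment> \<open>Distribute the arrow over the factors of \<open>B\<close>; the next step curries
    each of them separately.\<close>
  also have "\<dots> \<simeq> conj_list (map (Imp (factors_ty (factors A))) (map factor_ty ?ps))"
    unfolding factors_ty_def[of "factors B"] by (rule imp_conj_list) simp
  also have "\<dots> \<simeq> conj_list (map factor_ty (map ?g ?ps))"
    by (rule conj_list_cong)
      (auto simp del: factor_ty.simps intro!: imp_factor_ty simp: list.rel_map list_all2_same)
  also have "\<dots> \<simeq> factors_ty (factors (A \<^bold>\<rightarrow> B))"
    unfolding factors_ty_def by (rule conj_list_perm)
      (simp del: factor_ty.simps add: image_mset.compositionality)
  finally show ?case .
next
  case (Conj A B)
  have "A \<^bold>\<and> B \<simeq> factors_ty (factors A) \<^bold>\<and> factors_ty (factors B)"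
    using Conj by (rule ty_eq.Conj_cong)
  also have "\<dots> \<simeq> factors_ty (factors (A \<^bold>\<and> B))"
    using factors_ty_add ty_eq.sym by simp
  finally show ?case .
qed

text \<open>For the converse of soundness, types with the same normal form are both equivalent to
  the type read back from it.\<close>

lemma ty_eq_iff_factors: "A \<simeq> B \<longleftrightarrow> factors A = factors B"
  by (metis factors_eq_if_ty_eq ty_eq_factors_ty ty_eq.sym ty_eq.trans)

section \<open>Every non-empty multiset of factors is a normal form\<close>

lemma factors_conj_list:
  "As \<noteq> [] \<Longrightarrow> factors (conj_list As) = sum_list (map factors As)"
  by (induction As rule: conj_list.induct) auto

lemma factors_imp_list:
  "factors (imp_list As \<tau>) = {#Factor (sum_list (map factors As))#}"
  by (induction As) auto

lemma sum_list_singletons: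
  "(\<And>x. x \<in> set xs \<Longrightarrow> f x = {#g x#}) \<Longrightarrow> sum_list (map f xs) = mset (map g xs)"
  by (induction xs) auto

lemma factors_factor_ty: "factors (factor_ty p) = {#p#}"
proof (induction p)
  case (Factor M)
  have "sum_list (map factors (list_of_mset (image_mset factor_ty M)))
      = \<Sum>\<^sub># (image_mset factors (image_mset factor_ty M))"
    by (metis mset_list_of_mset mset_map sum_mset_sum_list)
  \<comment> \<open>By the induction hypothesis, each argument contributes itself as its only
    factor.\<close>
  also have "\<dots> = \<Sum>\<^sub># (image_mset (\<lambda>p. {#p#}) M)"
    by (simp add: image_mset.compositionality o_def Factor cong: image_mset_cong)
  also have "\<dots> = M"
    by simp
  finally show ?case by (simp add: factors_imp_list)
qed

text \<open>Lets each non-empty part of a normal form be realised by a type, as splitting an arrow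
  type requires.\<close>

lemma factors_factors_ty: "M \<noteq> {#} \<Longrightarrow> factors (factors_ty M) = M"
  by (simp add: factors_ty_def factors_conj_list o_def factors_factor_ty
      sum_list_singletons[where g = "\<lambda>p. p"])

section \<open>Cancellation and splitting of arrow types\<close>

lemma imp_right_cancel:
  assumes "A \<^bold>\<rightarrow> B \<simeq> A' \<^bold>\<rightarrow> B'" "A \<simeq> A'"
  shows "B \<simeq> B'"
proof -
  \<comment> \<open>Multiset addition is cancellative, so prefixing a fixed domain is injective on
    factors, and hence so is its image map on multisets.\<close>
  have "inj (\<lambda>p. Factor (factors A + arguments p))"
    by (rule injI) (metis add_left_imp_eq arguments.simps factor.exhaust factor.inject)
  then show ?thesis
    using assms multiset.inj_map[THEN injD] by (fastforce simp: ty_eq_iff_factors)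
qed

text \<open>A decomposition of the image of a multiset into a sum comes from a decomposition of the
  multiset itself. The two parts, read back as types, are the codomains.\<close>

lemma conj_eq_imp:
  assumes "C \<^bold>\<and> D \<simeq> A \<^bold>\<rightarrow> B"
  obtains B\<^sub>1 B\<^sub>2 where "B \<simeq> B\<^sub>1 \<^bold>\<and> B\<^sub>2" "C \<simeq> A \<^bold>\<rightarrow> B\<^sub>1" "D \<simeq> A \<^bold>\<rightarrow> B\<^sub>2"
proof -
  let ?g = "\<lambda>p. Factor (factors A + arguments p)"
  obtain M N where MN: "factors B = M + N"
      "factors C = image_mset ?g M" "factors D = image_mset ?g N"
    using assms by (auto simp: ty_eq_iff_factors dest!: image_mset_eq_plusD[OF HOL.sym])
  moreover have "M \<noteq> {#}" "N \<noteq> {#}"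
    using MN factors_nonempty by (metis image_mset_empty)+
  ultimately show thesis
    by (intro that[of "factors_ty M" "factors_ty N"])
      (simp_all add: ty_eq_iff_factors factors_factors_ty)
qed

section \<open>Labelled variables\<close>

text \<open>The free part of \<open>vars\<close>. Abstraction drops index 0 under every label, as
  occurrences need not carry the label of their binder.\<close>

fun fv :: "trm \<Rightarrow> (nat \<times> ty) set" where
  "fv (Var i A) = {(i, A)}"
| "fv (Lam A r) = {(i, B). (Suc i, B) \<in> fv r}"
| "fv (r \<cdot> s) = fv r \<union> fv s"
| "fv (r \<^bold>+ s) = fv r \<union> fv s"
| "fv (Proj A r) = fv r"

lemma bind_eq_Free [simp]: "bind x = Free i \<longleftrightarrow> x = Free (Suc i)"
  by (cases x rule: bind.cases) auto

lemma Free_eq_bind [simp]: "Free i = bind x \<longleftrightarrow> x = Free (Suc i)"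
  using bind_eq_Free by metis

lemma inj_bind: "inj bind"
proof (rule injI)
  fix x y :: name
  assume "bind x = bind y"
  then show "x = y" by (cases x rule: bind.cases; cases y rule: bind.cases) auto
qed

lemma Free_eq_child [simp]: "Free i = child d x \<longleftrightarrow> x = Free i"
  by (cases x) auto

lemma inj_child: "inj (child d)"
proof (rule injI)
  fix x y :: name
  assume "child d x = child d y"
  then show "x = y" by (cases x; cases y) auto
qed

lemma child_eq_child: "child d x = child e y \<Longrightarrow> d \<noteq> e \<Longrightarrow> \<exists>i. x = Free i \<and> y = Free i"
  by (cases x; cases y) auto

lemma Free_in_vars_iff: "(Free i, A) \<in> vars r \<longleftrightarrow> (i, A) \<in> fv r"
  by (induction r arbitrary: i) (force simp: image_iff)+

lemma single_valued_map_prod: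
  assumes "inj f"
  shows "single_valued (map_prod f id ` X) \<longleftrightarrow> single_valued X"
  using assms unfolding single_valued_def inj_def by (fastforce simp: image_iff)

lemma single_valued_Free:
  "functional (vars r) \<Longrightarrow> single_valued (fv r)"
  unfolding single_valued_def by (auto simp flip: Free_in_vars_iff)

text \<open>The added name is free, so it can clash only with labels recorded in
  \<open>fv r\<close>.\<close>

lemma functional_insert_Free:
  "functional (insert (Free i, A) (vars r)) \<longleftrightarrow>
    functional (vars r) \<and> single_valued (insert (i, A) (fv r))"
proof
  assume *: "functional (insert (Free i, A) (vars r))"
  then have "functional (vars r)"
    by (rule single_valued_subset[rotated]) blast
  then show "functional (vars r) \<and> single_valued (insert (i, A) (fv r))"
    using * single_valued_Free unfolding single_valued_def
    by (metis Free_in_vars_iff Pair_inject insert_iff)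
qed (auto simp: single_valued_def Free_in_vars_iff)

text \<open>Paths into different children differ, so the two subterms share no bound name; any clash
  between them is between free ones.\<close>

lemma functional_children:
  "functional (map_prod (child 0) id ` vars r \<union> map_prod (child 1) id ` vars s) \<longleftrightarrow>
    functional (vars r) \<and> functional (vars s) \<and> single_valued (fv r \<union> fv s)"
  (is "functional (?X \<union> ?Y) \<longleftrightarrow> ?R")
proof
  assume L: "functional (?X \<union> ?Y)"
  have "functional ?X" "functional ?Y"
    using L single_valued_subset[of _ "?X \<union> ?Y"] by blast+
  then have "functional (vars r)" "functional (vars s)"
    by (simp_all add: single_valued_map_prod inj_child)
  moreover have "(Free i, A) \<in> ?X \<union> ?Y" if "(i, A) \<in> fv r \<union> fv s" for i A
    using that by (force simp: image_iff simp flip: Free_in_vars_iff)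
  then have "single_valued (fv r \<union> fv s)"
    using L by (meson single_valuedD single_valuedI)
  ultimately show ?R by blast
next
  assume R: ?R
  show "functional (?X \<union> ?Y)"
  proof (rule single_valuedI)
    fix x A B
    assume A: "(x, A) \<in> ?X \<union> ?Y" and B: "(x, B) \<in> ?X \<union> ?Y"
    have sv: "functional ?X" "functional ?Y"
      using R by (simp_all add: single_valued_map_prod inj_child)
    have mixed: "C = D" if C: "(x, C) \<in> ?X" and D: "(x, D) \<in> ?Y" for C D
    proof -
      obtain y where y: "x = child 0 y" "(y, C) \<in> vars r"
        using C by auto
      obtain z where z: "x = child 1 z" "(z, D) \<in> vars s"
        using D by auto
      then obtain i where "y = Free i" "z = Free i"
        using child_eq_child[of 0 y 1 z] y z by auto
      then show ?thesis
        using y z R unfolding single_valued_def by (auto simp: Free_in_vars_iff)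
    qed
    show "A = B"
      using A B mixed sv single_valuedD by (metis Un_iff)
  qed
qed

lemma functional_Var [simp]: "functional (vars (Var i A))"
  by (simp add: single_valued_def)

lemma functional_Lam [simp]:
  "functional (vars (Lam A r)) \<longleftrightarrow>
    functional (vars r) \<and> single_valued (insert (0, A) (fv r))"
  using functional_insert_Free[of 0 A r]
  by (simp add: single_valued_map_prod[OF inj_bind] del: image_insert image_Un)

lemma functional_App [simp]:
  "functional (vars (r \<cdot> s)) \<longleftrightarrow>
    functional (vars r) \<and> functional (vars s) \<and> single_valued (fv r \<union> fv s)"
  using functional_children by simp

lemma functional_Plus [simp]:
  "functional (vars (r \<^bold>+ s)) \<longleftrightarrow>
    functional (vars r) \<and> functional (vars s) \<and> single_valued (fv r \<union> fv s)"
  using functional_children by simp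

lemma functional_Proj [simp]: "functional (vars (Proj A r)) \<longleftrightarrow> functional (vars r)"
  by simp

declare vars.simps [simp del]

text \<open>The inclusion belongs to the conclusion because the induction needs it: the condition
  added by each constructor concerns \<open>fv\<close> of the filled part.\<close>

lemma functional_plug:
  assumes "functional (vars (plug C r))" "functional (vars s)" "fv s \<subseteq> fv r"
  shows "functional (vars (plug C s)) \<and> fv (plug C s) \<subseteq> fv (plug C r)"
  using assms
proof (induction C)
qed (auto elim!: single_valued_subset[rotated])

section \<open>Typing\<close>

lemma typed_functional: "r \<Colon> A \<Longrightarrow> functional (vars r)"
  by (induction rule: typed.induct) (auto simp: functional_insert_Free)

text \<open>Conversion applies to terms of every shape; inversion collapses its consecutive uses
  into a single equivalence.\<close>

lemma typed_Var_iff: "Var i A \<Colon> C \<longleftrightarrow> A \<simeq> C"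
proof
  show "Var i A \<Colon> C \<Longrightarrow> A \<simeq> C"
    by (induction "Var i A" C rule: typed.induct) (auto intro: ty_eq.trans)
qed (auto intro: typed.intros)

lemma typed_Lam_iff:
  "Lam A r \<Colon> C \<longleftrightarrow> (\<exists>B. r \<Colon> B \<and> single_valued (insert (0, A) (fv r)) \<and> A \<^bold>\<rightarrow> B \<simeq> C)"
    (is "_ \<longleftrightarrow> ?R C")
proof
  show "Lam A r \<Colon> C \<Longrightarrow> ?R C"
    by (induction "Lam A r" C rule: typed.induct)
      (auto simp: functional_insert_Free intro: ty_eq.trans)
  show "?R C \<Longrightarrow> Lam A r \<Colon> C"
    by (auto intro!: typed.Conv[OF typed.Lam] simp: functional_insert_Free typed_functional)
qed

text \<open>A final conversion is pushed into the codomain of the function, so no separate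
  equivalence remains.\<close>

lemma typed_App_iff:
  "r \<cdot> s \<Colon> C \<longleftrightarrow>
    (\<exists>A. r \<Colon> A \<^bold>\<rightarrow> C \<and> s \<Colon> A \<and> single_valued (fv r \<union> fv s))" (is "_ \<longleftrightarrow> ?R C")
proof
  show "r \<cdot> s \<Colon> C \<Longrightarrow> ?R C"
  proof (induction "r \<cdot> s" C rule: typed.induct)
    case (Conv A B)
    then show ?case by (meson ty_eq.Imp_cong ty_eq.refl typed.Conv)
  qed auto
  show "?R C \<Longrightarrow> r \<cdot> s \<Colon> C"
    by (auto intro: typed.App simp: typed_functional)
qed

lemma typed_Plus_iff:
  "r \<^bold>+ s \<Colon> C \<longleftrightarrow>
    (\<exists>A B. r \<Colon> A \<and> s \<Colon> B \<and> single_valued (fv r \<union> fv s) \<and> A \<^bold>\<and> B \<simeq> C)" (is "_ \<longleftrightarrow> ?R C")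
proof
  show "r \<^bold>+ s \<Colon> C \<Longrightarrow> ?R C"
    by (induction "r \<^bold>+ s" C rule: typed.induct)
      (auto intro: ty_eq.trans, blast intro: ty_eq.refl)
  show "?R C \<Longrightarrow> r \<^bold>+ s \<Colon> C"
    by (auto intro!: typed.Conv[OF typed.Plus] simp: typed_functional)
qed

lemma typed_Proj_iff:
  "Proj A r \<Colon> C \<longleftrightarrow> A \<simeq> C \<and> (r \<Colon> A \<or> (\<exists>B. r \<Colon> A \<^bold>\<and> B))" (is "_ \<longleftrightarrow> ?R C")
proof
  show "Proj A r \<Colon> C \<Longrightarrow> ?R C"
    by (induction "Proj A r" C rule: typed.induct) (auto intro: ty_eq.trans)
  show "?R C \<Longrightarrow> Proj A r \<Colon> C"
    by (auto intro: typed.intros)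
qed

lemmas typed_iffs = typed_Var_iff typed_Lam_iff typed_App_iff typed_Plus_iff typed_Proj_iff

text \<open>Application is the case beyond congruence: the argument makes the two domains
  equivalent, and \<open>imp_right_cancel\<close> then compares the codomains.\<close>

lemma typed_unique: "\<lbrakk>r \<Colon> A; r \<Colon> B\<rbrakk> \<Longrightarrow> A \<simeq> B"
proof (induction arbitrary: B rule: typed.induct)
  case (Conv r A C)
  then show ?case by (meson ty_eq.sym ty_eq.trans)
next
  case (Lam r C A)
  then show ?case by (meson typed_Lam_iff ty_eq.Imp_cong ty_eq.refl ty_eq.trans)
next
  case (App r A C s)
  then show ?case by (meson typed_App_iff imp_right_cancel)
next
  case (Plus r A s C)
  then show ?case by (meson typed_Plus_iff ty_eq.Conj_cong ty_eq.trans)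
qed (auto simp: typed_Var_iff typed_Proj_iff)

lemma typed_plugD: "plug C r \<Colon> A \<Longrightarrow> \<exists>B. r \<Colon> B"
  by (induction C arbitrary: A) (auto simp: typed_iffs)

text \<open>Functionality of the target is a premise, since an equivalence step inside the hole may
  relabel one occurrence of a variable that also occurs in \<open>C\<close>.\<close>

lemma typed_plug:
  assumes "plug C r \<Colon> A" "functional (vars (plug C s))"
    and "\<And>B. r \<Colon> B \<Longrightarrow> functional (vars s) \<Longrightarrow> s \<Colon> B"
  shows "plug C s \<Colon> A"
  using assms(1,2)
proof (induction C arbitrary: A)
qed (fastforce simp: typed_iffs intro: assms(3))+

section \<open>Substitution\<close>

lemma fv_lift:
  "(i, A) \<in> fv (lift k r) \<longleftrightarrow> (if i < k then (i, A) \<in> fv r else k < i \<and> (i - 1, A) \<in> fv r)"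
proof (induction r arbitrary: i k)
  case (Lam B r)
  show ?case
    by (cases i) (auto simp: Lam)
qed auto

lemma single_valued_fv_lift:
  "single_valued (fv r \<union> fv s) \<Longrightarrow> single_valued (fv (lift k r) \<union> fv (lift k s))"
  unfolding single_valued_def by (auto simp: fv_lift split: if_splits)

lemma typed_lift: "r \<Colon> A \<Longrightarrow> lift k r \<Colon> A"
proof (induction arbitrary: k rule: typed.induct)
  case (Conv r A B)
  then show ?case by (blast intro: typed.Conv)
next
  case (Lam r B A)
  then have "single_valued (insert (0, A) (fv r))"
    by (simp add: functional_insert_Free)
  then have "single_valued (insert (0, A) (fv (lift (Suc k) r)))"
    unfolding single_valued_def by (auto simp: fv_lift split: if_splits)
  then show ?case using Lam.IH by (auto simp: typed_Lam_iff intro: ty_eq.refl)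
next
  case (App r A B s)
  then have "single_valued (fv (lift k r) \<union> fv (lift k s))"
    by (simp add: single_valued_fv_lift)
  then show ?case using App.IH by (auto simp: typed_App_iff)
next
  case (Plus r A s B)
  then have "single_valued (fv (lift k r) \<union> fv (lift k s))"
    by (simp add: single_valued_fv_lift)
  then show ?case using Plus.IH by (auto simp: typed_Plus_iff intro: ty_eq.refl)
qed (auto simp: typed_Var_iff typed_Proj_iff)

text \<open>What substitution for index \<open>k\<close> leaves of the free variables:
  \<open>k\<close> disappears under every label and larger indices drop by one. Written as a
  preimage, it avoids subtraction.\<close>

definition remove_index :: "nat \<Rightarrow> (nat \<times> ty) set \<Rightarrow> (nat \<times> ty) set" where
  "remove_index k X = {(i, A). (if i < k then i else Suc i, A) \<in> X}"

lemma in_remove_index_iff [simp]: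
  "(i, A) \<in> remove_index k X \<longleftrightarrow> (if i < k then i else Suc i, A) \<in> X"
  by (simp add: remove_index_def)

lemma remove_index_Un: "remove_index k (X \<union> Y) = remove_index k X \<union> remove_index k Y"
  by auto

text \<open>Only an inclusion, because \<open>s\<close> contributes nothing when \<open>k\<close>
  does not occur in \<open>r\<close>.\<close>

lemma fv_subst: "fv (subst k s r) \<subseteq> fv s \<union> remove_index k (fv r)"
proof (induction r arbitrary: k s)
  case (Lam A r)
  show ?case
  proof
    fix p assume p: "p \<in> fv (subst k s (Lam A r))"
    obtain i B where [simp]: "p = (i, B)" by (cases p)
    have "(Suc i, B) \<in> fv (lift 0 s) \<union> remove_index (Suc k) (fv r)"
      using p Lam[of "Suc k" "lift 0 s"] by auto
    then show "p \<in> fv s \<union> remove_index k (fv (Lam A r))"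
      by (auto simp: fv_lift split: if_splits)
  qed
next
  case (App r t)
  then show ?case
    unfolding subst.simps fv.simps remove_index_Un by blast
next
  case (Plus r t)
  then show ?case
    unfolding subst.simps fv.simps remove_index_Un by blast
qed auto

lemma single_valued_fv_subst:
  assumes "single_valued (fv s \<union> remove_index k (fv r \<union> fv t))"
  shows "single_valued (fv (subst k s r) \<union> fv (subst k s t))"
proof (rule single_valued_subset[OF _ assms])
  show "fv (subst k s r) \<union> fv (subst k s t) \<subseteq> fv s \<union> remove_index k (fv r \<union> fv t)"
    unfolding remove_index_Un using fv_subst[of k s r] fv_subst[of k s t] by blast
qed

text \<open>The first label condition gives each replaced occurrence the type of \<open>s\<close>;
  the second makes \<open>s\<close> compatible with the variables that remain.\<close>

lemma typed_subst:
  assumes "r \<Colon> B" "s \<Colon> A"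
    "single_valued (insert (k, A) (fv r))" "single_valued (fv s \<union> remove_index k (fv r))"
  shows "subst k s r \<Colon> B"
  using assms
proof (induction arbitrary: k s rule: typed.induct)
  case (Var i C)
  have "i = k \<Longrightarrow> C = A"
    using single_valuedD[OF Var.prems(2), of k C A] by simp
  then show ?case using Var.prems(1) by (simp add: typed_Var_iff)
next
  case (Conv r C B)
  then show ?case by (blast intro: typed.Conv)
next
  case (Lam r B C)
  have C: "single_valued (insert (0, C) (fv r))"
    using Lam.hyps by (simp add: functional_insert_Free)
  have A: "(i, D) \<in> fv r \<Longrightarrow> i = Suc k \<Longrightarrow> D = A" for i D
    using Lam.prems(2) unfolding single_valued_def by auto
  \<comment> \<open>This single set covers both the induction hypothesis and the condition at the
    binder.\<close>
  have sv: "single_valued (insert (0, C) (fv (lift 0 s) \<union> remove_index (Suc k) (fv r)))"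
  proof (rule single_valuedI)
    fix i D E
    assume *: "(i, D) \<in> insert (0, C) (fv (lift 0 s) \<union> remove_index (Suc k) (fv r))"
      "(i, E) \<in> insert (0, C) (fv (lift 0 s) \<union> remove_index (Suc k) (fv r))"
    show "D = E"
    proof (cases i)
      case 0
      \<comment> \<open>\<open>lift 0 s\<close> lacks index 0, and removing \<open>Suc k\<close>
        does not move it, so both labels come from \<open>r\<close> or the binder.\<close>
      then show ?thesis
        using * C unfolding single_valued_def by (auto simp: fv_lift)
    next
      case (Suc j)
      then have "(j, D) \<in> fv s \<union> remove_index k (fv (Lam C r))"
        "(j, E) \<in> fv s \<union> remove_index k (fv (Lam C r))"
        using * by (auto simp: fv_lift split: if_splits)
      then show ?thesis
        using Lam.prems(3) by (meson single_valuedD)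
    qed
  qed
  have "subst (Suc k) (lift 0 s) r \<Colon> B"
  proof (rule Lam.IH)
    show "lift 0 s \<Colon> A" using Lam.prems by (simp add: typed_lift)
    show "single_valued (insert (Suc k, A) (fv r))"
      using C A unfolding single_valued_def by blast
    show "single_valued (fv (lift 0 s) \<union> remove_index (Suc k) (fv r))"
      by (rule single_valued_subset[OF _ sv]) blast
  qed
  moreover have "single_valued (insert (0, C) (fv (subst (Suc k) (lift 0 s) r)))"
    using fv_subst by (intro single_valued_subset[OF _ sv]) blast
  ultimately show ?case by (auto simp: typed_Lam_iff)
next
  case (App r C B t)
  have "subst k s r \<Colon> C \<^bold>\<rightarrow> B" "subst k s t \<Colon> C"
    by (rule App.IH[OF App.prems(1) single_valued_subset[OF _ App.prems(2)]
        single_valued_subset[OF _ App.prems(3)]]; auto)+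
  moreover have "single_valued (fv (subst k s r) \<union> fv (subst k s t))"
    using single_valued_fv_subst App.prems by simp
  ultimately show ?case by (auto simp: typed_App_iff)
next
  case (Plus r C t D)
  have "subst k s r \<Colon> C" "subst k s t \<Colon> D"
    by (rule Plus.IH[OF Plus.prems(1) single_valued_subset[OF _ Plus.prems(2)]
        single_valued_subset[OF _ Plus.prems(3)]]; auto)+
  moreover have "single_valued (fv (subst k s r) \<union> fv (subst k s t))"
    using single_valued_fv_subst Plus.prems by simp
  ultimately show ?case by (auto simp: typed_Plus_iff intro: ty_eq.refl)
next
  case (Proj_self r C)
  then show ?case by (simp add: typed_Proj_iff)
next
  case (Proj r C D)
  then show ?case by (auto simp: typed_Proj_iff)
qed

section \<open>Subject reduction\<close>

lemma ty_repl_eq: "A \<simeq> B \<Longrightarrow> ty_repl A B C \<simeq> C"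
  by (induction C) (auto intro: ty_eq.intros)

lemma typed_trm_repl:
  assumes "A \<simeq> B" "r \<Colon> C" "functional (vars (trm_repl A B r))"
  shows "trm_repl A B r \<Colon> C"
  using assms(2,3)
proof (induction r arbitrary: C)
  case (Var i D)
  then show ?case
    using ty_repl_eq[OF assms(1)] by (auto simp: typed_Var_iff intro: ty_eq.trans)
next
  case (Lam D r)
  then obtain E where "r \<Colon> E" "D \<^bold>\<rightarrow> E \<simeq> C" by (auto simp: typed_Lam_iff)
  moreover have "ty_repl A B D \<^bold>\<rightarrow> E \<simeq> D \<^bold>\<rightarrow> E"
    by (simp add: ty_eq.Imp_cong ty_repl_eq[OF assms(1)])
  ultimately show ?case
    using Lam by (auto simp: typed_Lam_iff intro!: exI[of _ E] intro: ty_eq.trans)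
next
  case (App r s)
  then show ?case by (fastforce simp: typed_App_iff)
next
  case (Plus r s)
  then show ?case by (fastforce simp: typed_Plus_iff)
next
  case (Proj D r)
  let ?D = "ty_repl A B D"
  have D: "?D \<simeq> D" by (rule ty_repl_eq[OF assms(1)])
  have C: "D \<simeq> C" using Proj.prems by (simp add: typed_Proj_iff)
  have "trm_repl A B r \<Colon> D \<or> (\<exists>E. trm_repl A B r \<Colon> D \<^bold>\<and> E)"
    using Proj by (auto simp: typed_Proj_iff)
  \<comment> \<open>The subscript itself has changed, so the argument is converted to match the new
    one.\<close>
  then have "trm_repl A B r \<Colon> ?D \<or> (\<exists>E. trm_repl A B r \<Colon> ?D \<^bold>\<and> E)"
    using D by (meson typed.Conv ty_eq.sym ty_eq.Conj_cong ty_eq.refl)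
  then show ?case
    using D C by (auto simp: typed_Proj_iff intro: ty_eq.trans)
qed

text \<open>Replacement can identify distinct labels and need not be undone by the opposite
  replacement. Hence the separate induction, with functionality of \<open>r\<close> as a
  premise.\<close>

lemma typed_trm_replD:
  assumes "A \<simeq> B" "trm_repl A B r \<Colon> C" "functional (vars r)"
  shows "r \<Colon> C"
  using assms(2,3)
proof (induction r arbitrary: C)
  case (Var i D)
  then show ?case
    using ty_repl_eq[OF assms(1), THEN ty_eq.sym]
    by (auto simp: typed_Var_iff intro: ty_eq.trans)
next
  case (Lam D r)
  then obtain E where "trm_repl A B r \<Colon> E" "ty_repl A B D \<^bold>\<rightarrow> E \<simeq> C"
    by (auto simp: typed_Lam_iff)
  moreover have "D \<^bold>\<rightarrow> E \<simeq> ty_repl A B D \<^bold>\<rightarrow> E"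
    by (simp add: ty_eq.Imp_cong ty_repl_eq[OF assms(1), THEN ty_eq.sym])
  ultimately show ?case
    using Lam by (auto simp: typed_Lam_iff intro!: exI[of _ E] intro: ty_eq.trans)
next
  case (App r s)
  then show ?case by (fastforce simp: typed_App_iff)
next
  case (Plus r s)
  then show ?case by (fastforce simp: typed_Plus_iff)
next
  case (Proj D r)
  let ?D = "ty_repl A B D"
  have D: "?D \<simeq> D" by (rule ty_repl_eq[OF assms(1)])
  have C: "?D \<simeq> C" using Proj.prems by (simp add: typed_Proj_iff)
  have "r \<Colon> ?D \<or> (\<exists>E. r \<Colon> ?D \<^bold>\<and> E)"
    using Proj by (auto simp: typed_Proj_iff)
  then have "r \<Colon> D \<or> (\<exists>E. r \<Colon> D \<^bold>\<and> E)"
    using D by (meson typed.Conv ty_eq.Conj_cong ty_eq.refl)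
  then show ?case
    using D C by (auto simp: typed_Proj_iff intro: ty_eq.trans ty_eq.sym)
qed

section \<open>Invariance of typing under the equivalence rules\<close>

lemma typed_Plus_commD: "r \<^bold>+ s \<Colon> A \<Longrightarrow> s \<^bold>+ r \<Colon> A"
  unfolding typed_Plus_iff by (metis Un_commute ty_eq.comm ty_eq.trans)

lemma typed_Plus_assocD:
  assumes "(r \<^bold>+ s) \<^bold>+ t \<Colon> A" "functional (vars (r \<^bold>+ (s \<^bold>+ t)))"
  shows "r \<^bold>+ (s \<^bold>+ t) \<Colon> A"
proof -
  obtain D B C E where *: "r \<Colon> B" "s \<Colon> C" "t \<Colon> D" "B \<^bold>\<and> C \<simeq> E" "E \<^bold>\<and> D \<simeq> A"
    using assms(1) by (auto simp: typed_Plus_iff)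
  then have "B \<^bold>\<and> C \<^bold>\<and> D \<simeq> A"
    by (metis ty_eq_iff_factors factors.simps(3) add.assoc)
  moreover have "r \<^bold>+ (s \<^bold>+ t) \<Colon> B \<^bold>\<and> C \<^bold>\<and> D"
    using assms(2) * by (intro typed.Plus) auto
  ultimately show ?thesis by (blast intro: typed.Conv)
qed

lemma typed_Plus_assocD':
  assumes "r \<^bold>+ (s \<^bold>+ t) \<Colon> A" "functional (vars ((r \<^bold>+ s) \<^bold>+ t))"
  shows "(r \<^bold>+ s) \<^bold>+ t \<Colon> A"
proof -
  obtain D B C E where *: "r \<Colon> B" "s \<Colon> C" "t \<Colon> D" "C \<^bold>\<and> D \<simeq> E" "B \<^bold>\<and> E \<simeq> A"
    using assms(1) by (auto simp: typed_Plus_iff)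
  then have "(B \<^bold>\<and> C) \<^bold>\<and> D \<simeq> A"
    by (metis ty_eq_iff_factors factors.simps(3) add.assoc)
  moreover have "(r \<^bold>+ s) \<^bold>+ t \<Colon> (B \<^bold>\<and> C) \<^bold>\<and> D"
    using assms(2) * by (intro typed.Plus) auto
  ultimately show ?thesis by (blast intro: typed.Conv)
qed

lemma typed_Lam_PlusD:
  assumes "Lam A (r \<^bold>+ s) \<Colon> B" "functional (vars (Lam A r \<^bold>+ Lam A s))"
  shows "Lam A r \<^bold>+ Lam A s \<Colon> B"
proof -
  obtain E C D where *: "r \<Colon> C" "s \<Colon> D" "C \<^bold>\<and> D \<simeq> E" "A \<^bold>\<rightarrow> E \<simeq> B"
    using assms(1) by (auto simp: typed_Lam_iff typed_Plus_iff)
  then have "(A \<^bold>\<rightarrow> C) \<^bold>\<and> (A \<^bold>\<rightarrow> D) \<simeq> B"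
    by (meson ty_eq.distrib ty_eq.sym ty_eq.trans ty_eq.Imp_cong ty_eq.refl)
  moreover have "Lam A r \<Colon> A \<^bold>\<rightarrow> C" "Lam A s \<Colon> A \<^bold>\<rightarrow> D"
    using * assms(2) by (auto intro!: typed.Lam simp: functional_insert_Free)
  then have "Lam A r \<^bold>+ Lam A s \<Colon> (A \<^bold>\<rightarrow> C) \<^bold>\<and> (A \<^bold>\<rightarrow> D)"
    using assms(2) by (rule typed.Plus)
  ultimately show ?thesis by (blast intro: typed.Conv)
qed

lemma typed_Lam_PlusD':
  assumes "Lam A r \<^bold>+ Lam A s \<Colon> B" "functional (vars (Lam A (r \<^bold>+ s)))"
  shows "Lam A (r \<^bold>+ s) \<Colon> B"
proof -
  obtain C D where *: "r \<Colon> C" "s \<Colon> D" and "(A \<^bold>\<rightarrow> C) \<^bold>\<and> (A \<^bold>\<rightarrow> D) \<simeq> B"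
    using assms(1) unfolding typed_Lam_iff typed_Plus_iff
    by (meson ty_eq.Conj_cong ty_eq.trans)
  then have "A \<^bold>\<rightarrow> C \<^bold>\<and> D \<simeq> B"
    by (meson ty_eq.distrib ty_eq.trans)
  moreover have "Lam A (r \<^bold>+ s) \<Colon> A \<^bold>\<rightarrow> C \<^bold>\<and> D"
    using * assms(2) by (auto intro!: typed.Lam typed.Plus simp: functional_insert_Free)
  ultimately show ?thesis by (blast intro: typed.Conv)
qed

text \<open>The types of the summands form a conjunction equivalent to an arrow;
  \<open>conj_eq_imp\<close> splits it into two arrows with the common domain
  \<open>A\<close>.\<close>

lemma typed_Plus_AppD:
  assumes "(r \<^bold>+ s) \<cdot> t \<Colon> B" "functional (vars (r \<cdot> t \<^bold>+ s \<cdot> t))"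
  shows "r \<cdot> t \<^bold>+ s \<cdot> t \<Colon> B"
proof -
  obtain A C D where *: "r \<Colon> C" "s \<Colon> D" "t \<Colon> A" "C \<^bold>\<and> D \<simeq> A \<^bold>\<rightarrow> B"
    using assms(1) by (auto simp: typed_App_iff typed_Plus_iff)
  then obtain B\<^sub>1 B\<^sub>2 where B: "B \<simeq> B\<^sub>1 \<^bold>\<and> B\<^sub>2" "C \<simeq> A \<^bold>\<rightarrow> B\<^sub>1" "D \<simeq> A \<^bold>\<rightarrow> B\<^sub>2"
    by (auto elim: conj_eq_imp)
  have "r \<cdot> t \<Colon> B\<^sub>1" "s \<cdot> t \<Colon> B\<^sub>2"
    using * B assms(2) by (auto intro!: typed.App intro: typed.Conv)
  then have "r \<cdot> t \<^bold>+ s \<cdot> t \<Colon> B\<^sub>1 \<^bold>\<and> B\<^sub>2"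
    using assms(2) by (rule typed.Plus)
  then show ?thesis using B(1) by (blast intro: typed.Conv ty_eq.sym)
qed

text \<open>The two applications may assign different domains to \<open>t\<close>; uniqueness of its
  type reconciles them before \<open>distrib\<close> is used backwards.\<close>

lemma typed_Plus_AppD':
  assumes "r \<cdot> t \<^bold>+ s \<cdot> t \<Colon> B" "functional (vars ((r \<^bold>+ s) \<cdot> t))"
  shows "(r \<^bold>+ s) \<cdot> t \<Colon> B"
proof -
  obtain A\<^sub>1 B\<^sub>1 A\<^sub>2 B\<^sub>2 where *: "r \<Colon> A\<^sub>1 \<^bold>\<rightarrow> B\<^sub>1" "t \<Colon> A\<^sub>1" "s \<Colon> A\<^sub>2 \<^bold>\<rightarrow> B\<^sub>2" "t \<Colon> A\<^sub>2" "B\<^sub>1 \<^bold>\<and> B\<^sub>2 \<simeq> B"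
    using assms(1) unfolding typed_App_iff typed_Plus_iff by metis
  have "A\<^sub>2 \<^bold>\<rightarrow> B\<^sub>2 \<simeq> A\<^sub>1 \<^bold>\<rightarrow> B\<^sub>2"
    using * by (meson typed_unique ty_eq.Imp_cong ty_eq.refl)
  then have "r \<^bold>+ s \<Colon> (A\<^sub>1 \<^bold>\<rightarrow> B\<^sub>1) \<^bold>\<and> (A\<^sub>1 \<^bold>\<rightarrow> B\<^sub>2)"
    using * assms(2) by (auto intro!: typed.Plus intro: typed.Conv)
  moreover have "(A\<^sub>1 \<^bold>\<rightarrow> B\<^sub>1) \<^bold>\<and> (A\<^sub>1 \<^bold>\<rightarrow> B\<^sub>2) \<simeq> A\<^sub>1 \<^bold>\<rightarrow> B"
    using *(5) by (meson ty_eq.distrib ty_eq.sym ty_eq.trans ty_eq.Imp_cong ty_eq.refl)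
  ultimately have "r \<^bold>+ s \<Colon> A\<^sub>1 \<^bold>\<rightarrow> B"
    by (rule typed.Conv)
  then show ?thesis using *(2) assms(2) by (rule typed.App)
qed

lemma typed_Proj_LamD:
  assumes "Proj (A \<^bold>\<rightarrow> B) (Lam A r) \<Colon> C"
  shows "Lam A (Proj B r) \<Colon> C"
proof -
  have C: "A \<^bold>\<rightarrow> B \<simeq> C"
    using assms by (simp add: typed_Proj_iff)
  obtain E where E: "r \<Colon> E" "single_valued (insert (0, A) (fv r))"
    "A \<^bold>\<rightarrow> E \<simeq> A \<^bold>\<rightarrow> B \<or> (\<exists>D. A \<^bold>\<rightarrow> E \<simeq> (A \<^bold>\<rightarrow> B) \<^bold>\<and> D)"
    using assms unfolding typed_Proj_iff typed_Lam_iff by blast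
  \<comment> \<open>If the arrow type of the abstraction has a conjunct \<open>D\<close> besides the
    subscript, \<open>conj_eq_imp\<close> moves the splitting into the body type \<open>E\<close>,
    and cancellation identifies its first part with \<open>B\<close>.\<close>
  from E(3) have "E \<simeq> B \<or> (\<exists>D. E \<simeq> B \<^bold>\<and> D)"
  proof (elim disjE exE)
    fix D
    assume "A \<^bold>\<rightarrow> E \<simeq> (A \<^bold>\<rightarrow> B) \<^bold>\<and> D"
    then obtain E\<^sub>1 E\<^sub>2 where "E \<simeq> E\<^sub>1 \<^bold>\<and> E\<^sub>2" "A \<^bold>\<rightarrow> B \<simeq> A \<^bold>\<rightarrow> E\<^sub>1"
      using conj_eq_imp ty_eq.sym by metis
    then show ?thesis
      by (meson imp_right_cancel ty_eq.refl ty_eq.sym ty_eq.trans ty_eq.Conj_cong)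
  qed (auto dest: imp_right_cancel)
  then have "Proj B r \<Colon> B"
    using E(1) by (auto simp: typed_Proj_iff intro: typed.Conv)
  then show ?thesis
    using E(2) C by (auto simp: typed_Lam_iff)
qed

lemma typed_Lam_ProjD:
  assumes "Lam A (Proj B r) \<Colon> C"
  shows "Proj (A \<^bold>\<rightarrow> B) (Lam A r) \<Colon> C"
proof -
  obtain B' where B': "B \<simeq> B'" "A \<^bold>\<rightarrow> B' \<simeq> C" "single_valued (insert (0, A) (fv r))"
    and r: "r \<Colon> B \<or> (\<exists>D. r \<Colon> B \<^bold>\<and> D)"
    using assms by (auto simp: typed_Lam_iff typed_Proj_iff)
  have "A \<^bold>\<rightarrow> B \<simeq> C"
    using B' by (meson ty_eq.Imp_cong ty_eq.refl ty_eq.trans)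
  moreover have "Lam A r \<Colon> A \<^bold>\<rightarrow> B \<or> (\<exists>D. Lam A r \<Colon> (A \<^bold>\<rightarrow> B) \<^bold>\<and> D)"
    using r B'(3) unfolding typed_Lam_iff by (meson ty_eq.refl ty_eq.distrib)
  ultimately show ?thesis by (simp add: typed_Proj_iff)
qed

text \<open>The rule \<open>sym\<close> forces both directions into the induction.\<close>

lemma equiv_step_typed:
  assumes "r \<rightleftharpoons> s"
  shows "(r \<Colon> A \<longrightarrow> functional (vars s) \<longrightarrow> s \<Colon> A) \<and> (s \<Colon> A \<longrightarrow> functional (vars r) \<longrightarrow> r \<Colon> A)"
  using assms
proof (induction arbitrary: A rule: equiv_step.induct)
  case (sym r s)
  then show ?case by blast
next
  case (ctx r s C)
  then show ?case using typed_plug by meson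
next
  case (comm r s)
  then show ?case using typed_Plus_commD by blast
next
  case (assoc r s t)
  then show ?case using typed_Plus_assocD typed_Plus_assocD' by blast
next
  case (dist_Lam B r s)
  then show ?case using typed_Lam_PlusD typed_Lam_PlusD' by blast
next
  case (dist_App r s t)
  then show ?case using typed_Plus_AppD typed_Plus_AppD' by blast
next
  case (dist_Proj_Lam B C r)
  then show ?case using typed_Proj_LamD typed_Lam_ProjD by blast
next
  case (dist_Proj_App r B C D s)
  \<comment> \<open>The premise on \<open>s\<close> fixes the domain by uniqueness, so cancellation
    determines the codomain.\<close>
  have "A \<simeq> C" if "Proj (B \<^bold>\<rightarrow> C) r \<cdot> s \<Colon> A"
    using that dist_Proj_App(2) unfolding typed_App_iff typed_Proj_iff
    by (meson imp_right_cancel typed_unique ty_eq.sym)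
  moreover have "A \<simeq> C" if "Proj C (r \<cdot> s) \<Colon> A"
    using that by (auto simp: typed_Proj_iff intro: ty_eq.sym)
  moreover have "Proj C (r \<cdot> s) \<Colon> C" if "functional (vars (Proj C (r \<cdot> s)))"
    using that dist_Proj_App by (intro typed.Proj[OF typed.App]) auto
  moreover have "Proj (B \<^bold>\<rightarrow> C) r \<cdot> s \<Colon> C" if "functional (vars (Proj (B \<^bold>\<rightarrow> C) r \<cdot> s))"
    using that dist_Proj_App(2) typed.Proj[OF typed.Conv[OF dist_Proj_App(1) ty_eq.distrib]]
    by (intro typed.App)
  ultimately show ?case
    by (meson typed.Conv ty_eq.sym)
next
  case (curry r s t)
  have "r \<cdot> (s \<^bold>+ t) \<Colon> A" if typed: "r \<cdot> s \<cdot> t \<Colon> A" and functional: "functional (vars (r \<cdot> (s \<^bold>+ t)))"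
  proof -
    obtain B C where *: "r \<Colon> B \<^bold>\<rightarrow> C \<^bold>\<rightarrow> A" "s \<Colon> B" "t \<Colon> C"
      using typed by (auto simp: typed_App_iff)
    then have "r \<Colon> (B \<^bold>\<and> C) \<^bold>\<rightarrow> A"
      by (blast intro: typed.Conv ty_eq.sym ty_eq.curry)
    then show ?thesis
      using * functional by (auto intro!: typed.App typed.Plus)
  qed
  moreover have "r \<cdot> s \<cdot> t \<Colon> A" if typed: "r \<cdot> (s \<^bold>+ t) \<Colon> A" and functional: "functional (vars (r \<cdot> s \<cdot> t))"
  proof -
    obtain E B C where *: "r \<Colon> E \<^bold>\<rightarrow> A" "s \<Colon> B" "t \<Colon> C" "B \<^bold>\<and> C \<simeq> E"
      using typed by (auto simp: typed_App_iff typed_Plus_iff)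
    have "E \<^bold>\<rightarrow> A \<simeq> B \<^bold>\<rightarrow> C \<^bold>\<rightarrow> A"
      using *(4) by (meson ty_eq.curry ty_eq.Imp_cong ty_eq.refl ty_eq.sym ty_eq.trans)
    then have "r \<Colon> B \<^bold>\<rightarrow> C \<^bold>\<rightarrow> A"
      using *(1) by (blast intro: typed.Conv)
    then show ?thesis
      using * functional by (auto intro!: typed.App)
  qed
  ultimately show ?case by blast
next
  case (repl B C r)
  then show ?case using typed_trm_repl typed_trm_replD by blast
next
  case (split r B C s D E)
  let ?l = "Proj (B \<^bold>\<and> D) (r \<^bold>+ s)" and ?r = "Proj B r \<^bold>+ Proj D s"
  \<comment> \<open>The subscripts determine the type on either side, so it remains to give each
    functional side that type.\<close>
  have "B \<^bold>\<and> D \<simeq> A" if "?l \<Colon> A \<or> ?r \<Colon> A"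
    using that unfolding typed_Proj_iff typed_Plus_iff
    by (meson ty_eq.Conj_cong ty_eq.trans)
  moreover have "?l \<Colon> B \<^bold>\<and> D" if "functional (vars ?l)"
  proof -
    have "r \<^bold>+ s \<Colon> (B \<^bold>\<and> C) \<^bold>\<and> (D \<^bold>\<and> E)"
      using split that by (auto intro: typed.Plus)
    moreover have "(B \<^bold>\<and> C) \<^bold>\<and> (D \<^bold>\<and> E) \<simeq> (B \<^bold>\<and> D) \<^bold>\<and> (C \<^bold>\<and> E)"
      by (simp add: ty_eq_iff_factors ac_simps)
    ultimately show ?thesis by (blast intro: typed.Proj typed.Conv)
  qed
  moreover have "?r \<Colon> B \<^bold>\<and> D" if "functional (vars ?r)"
    using split that by (auto intro: typed.Plus typed.Proj)
  ultimately show ?case by (meson typed.Conv)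
qed

section \<open>Preservation of typing under reduction\<close>

lemma red_nd_typed:
  assumes "r \<hookrightarrow>\<^sub>0 s" "r \<Colon> B"
  shows "s \<Colon> B \<and> fv s \<subseteq> fv r"
  using assms
proof (cases rule: red_nd.cases)
  case (beta s' A r')
  obtain A' C where r': "r' \<Colon> C" and eq: "A \<^bold>\<rightarrow> C \<simeq> A' \<^bold>\<rightarrow> B" and s': "s' \<Colon> A'"
    and sv: "single_valued (insert (0, A) (fv r'))" "single_valued (fv (Lam A r') \<union> fv s')"
    using assms(2) unfolding beta(1) typed_App_iff typed_Lam_iff by blast
  have remove: "remove_index 0 (fv r') = fv (Lam A r')"
    by auto
  \<comment> \<open>The argument has both the label of the binder and the domain of the function as
    types; they are equivalent and cancel.\<close>
  have "C \<simeq> B"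
    using eq s' beta(3) imp_right_cancel typed_unique by blast
  moreover have "subst 0 s' r' \<Colon> C"
    using r' beta(3) sv remove by (intro typed_subst) (auto simp: Un_commute)
  moreover have "fv (subst 0 s' r') \<subseteq> fv (Lam A r' \<cdot> s')"
    using fv_subst[of 0 s' r'] remove by auto
  ultimately show ?thesis
    unfolding beta by (blast intro: typed.Conv)
next
  case (Proj_Plus A t)
  then show ?thesis using assms(2) by (auto simp: typed_Proj_iff intro: typed.Conv)
next
  case (Proj_self A)
  then show ?thesis using assms(2) by (auto simp: typed_Proj_iff intro: typed.Conv)
qed

text \<open>Here functionality of the target is derived: the new part is typed, and without new
  labelled free variables it cannot conflict with the context.\<close>

lemma typed_plug_fv:
  assumes "plug C r \<Colon> A" "\<And>B. r \<Colon> B \<Longrightarrow> s \<Colon> B" "fv s \<subseteq> fv r"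
  shows "plug C s \<Colon> A"
proof (rule typed_plug[OF assms(1)])
  obtain B where "r \<Colon> B" using assms(1) typed_plugD by blast
  then have "functional (vars s)" using assms(2) typed_functional by blast
  then show "functional (vars (plug C s))"
    using functional_plug assms(1,3) typed_functional by blast
qed (rule assms(2))

text \<open>The two copies of \<open>r\<close> have the same labelled free variables, and these are
  consistent because \<open>r\<close> is typed.\<close>

lemma delta_typed:
  assumes "r \<Colon> A \<^bold>\<and> B" "r \<Colon> D"
  shows "Proj A r \<^bold>+ Proj B r \<Colon> D"
proof -
  have "r \<Colon> B \<^bold>\<and> A"
    using assms(1) by (blast intro: typed.Conv ty_eq.comm)
  moreover have "A \<^bold>\<and> B \<simeq> D"
    using assms by (rule typed_unique)
  moreover have "functional (vars r)"
    using assms(1) by (rule typed_functional)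
  ultimately show ?thesis
    using assms(1)
    by (auto simp: single_valued_Free intro!: typed.Conv[OF typed.Plus] intro: typed.Proj)
qed

lemma red_typed: "r \<hookrightarrow> s \<Longrightarrow> r \<Colon> A \<Longrightarrow> s \<Colon> A"
proof (induction rule: red.induct)
  case (nd r s C)
  then obtain B where "r \<Colon> B" using typed_plugD by blast
  then show ?case using nd red_nd_typed typed_plug_fv by metis
next
  case (delta r B D C)
  show ?case
    by (rule typed_plug_fv[OF delta.prems]) (auto intro: delta_typed[OF delta.hyps(1)])
qed

text \<open>For an equivalence step, functionality of \<open>s\<close> is a premise because
  relabelling a single occurrence can produce a term without a type.\<close>

theorem theorem1:
  fixes r s :: trm and A :: ty
  assumes "r \<Colon> A"
    and "r \<hookrightarrow> s \<or> (r \<rightleftharpoons> s \<and> functional (vars s))"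
  shows "s \<Colon> A"
  using assms red_typed equiv_step_typed by blast

end
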